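(* Let $D$ be a domain and let $M$ be a torsion-free $D$-module. Let $\kappa$ be the cardinality of the set of nonzero $D$-submodules of $M$. Suppose that there exist an ideal $I$ of $D$ and a $D$-submodule $N$ of $M$ such that $0\neq I\neq D$, $IM\subseteq N$, and $$|\operatorname{Hom}_D(I,M/N)|>\kappa.$$ Then $$|\mathcal A^*(D\ltimes M)|<|\mathcal I^*(D\ltimes M)|.$$
   Context: A domain is a commutative integral domain with identity. A $D$-module $M$ is torsion-free if $dx=0$ with $d\in D$, $x\in M$ implies $d=0$ or $x=0$. For a commutative ring $D$ and a $D$-module $M$, the idealization $D\ltimes M$ is the commutative ring whose additive group is $D\oplus M$ and whose multiplication is $(d,m)(d',m')=(dd',dm'+d'm)$. For a commutative ring $R$ with identity, $\mathcal I^*(R)$ denotes the set of ideals $I$ of $R$ with $0\neq I\neq R$, and $\mathcal A^*(R)$ denotes the set of those $I\in\mathcal I^*(R)$ with $\operatorname{Ann}_R(I)=\{r\in R:rI=0\}\neq 0$. $|X|$ denotes the cardinality of a set $X$. *)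

theory Defs
  imports "HOL-Algebra.Ideal" "HOL-Algebra.Module" "HOL-Library.FuncSet" "HOL-Library.Equipollence"
begin

section \<open>Modules\<close>

definition torsion_free :: "('a, 'c) ring_scheme \<Rightarrow> ('a, 'm, 'd) module_scheme \<Rightarrow> bool"
  where "torsion_free D M \<longleftrightarrow>
    (\<forall>d\<in>carrier D. \<forall>x\<in>carrier M. d \<odot>\<^bsub>M\<^esub> x = \<zero>\<^bsub>M\<^esub> \<longrightarrow> d = \<zero>\<^bsub>D\<^esub> \<or> x = \<zero>\<^bsub>M\<^esub>)"

definition nonzero_submodules :: "('a, 'c) ring_scheme \<Rightarrow> ('a, 'm, 'd) module_scheme \<Rightarrow> 'm set set"
  where "nonzero_submodules D M = {N. submodule N D M \<and> N \<noteq> {\<zero>\<^bsub>M\<^esub>}}"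

text \<open>The submodule \<open>IM\<close> of finite sums of products \<open>ax\<close>; for an ideal \<open>I\<close> the
  empty sum is covered by \<open>\<zero> \<odot> \<zero>\<close>.\<close>

inductive_set ideal_smult :: "'a set \<Rightarrow> ('a, 'm, 'd) module_scheme \<Rightarrow> 'm set"
  for I M where
    prod: "\<lbrakk>a \<in> I; x \<in> carrier M\<rbrakk> \<Longrightarrow> a \<odot>\<^bsub>M\<^esub> x \<in> ideal_smult I M"
  | sum: "\<lbrakk>x \<in> ideal_smult I M; y \<in> ideal_smult I M\<rbrakk> \<Longrightarrow> x \<oplus>\<^bsub>M\<^esub> y \<in> ideal_smult I M"

text \<open>The record type \<^typ>\<open>('a, 'm) module\<close> extends that of rings; modules do not use the
  fields \<^const>\<open>mult\<close> and \<^const>\<open>one\<close>.\<close>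

definition ideal_module :: "('a, 'c) ring_scheme \<Rightarrow> 'a set \<Rightarrow> ('a, 'a) module"
  where "ideal_module D I =
    \<lparr>carrier = I, mult = mult D, one = one D, zero = zero D, add = add D, smult = mult D\<rparr>"

definition quotient_module :: "('a, 'm, 'd) module_scheme \<Rightarrow> 'm set \<Rightarrow> ('a, 'm set) module"
  where "quotient_module M N =
    \<lparr>carrier = a_rcosets\<^bsub>M\<^esub> N, mult = undefined, one = undefined, zero = N, add = set_add M,
     smult = (\<lambda>d X. \<Union>x\<in>X. N +>\<^bsub>M\<^esub> (d \<odot>\<^bsub>M\<^esub> x))\<rparr>"

text \<open>Homomorphisms are extensional functions, so that distinct elements of this set differ
  as maps on the carrier and its cardinality is that of \<open>Hom\<^sub>D(M, N)\<close>.\<close>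

definition module_Hom ::
  "('a, 'c) ring_scheme \<Rightarrow> ('a, 'm, 'd) module_scheme \<Rightarrow> ('a, 'n, 'e) module_scheme \<Rightarrow> ('m \<Rightarrow> 'n) set"
  where "module_Hom D M N = {f \<in> carrier M \<rightarrow>\<^sub>E carrier N.
    (\<forall>x\<in>carrier M. \<forall>y\<in>carrier M. f (x \<oplus>\<^bsub>M\<^esub> y) = f x \<oplus>\<^bsub>N\<^esub> f y) \<and>
    (\<forall>d\<in>carrier D. \<forall>x\<in>carrier M. f (d \<odot>\<^bsub>M\<^esub> x) = d \<odot>\<^bsub>N\<^esub> f x)}"

lemma (in cring) module_ideal_module:
  assumes "ideal I R"
  shows "module R (ideal_module R I)"
proof -
  interpret ideal I R by fact
  show ?thesis
  proof (intro moduleI abelian_groupI is_cring; simp add: ideal_module_def I_l_closed)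
    show "\<exists>y\<in>I. y \<oplus> x = \<zero>" if "x \<in> I" for x
      using that by (intro bexI[of _ "\<ominus> x"]) (auto simp: l_neg Icarr)
  qed (simp_all add: Icarr l_distr r_distr m_assoc a_ac)
qed

lemma (in module) module_quotient_module:
  assumes "submodule N R M"
  shows "module R (quotient_module M N)"
proof -
  interpret N: submodule N R M by fact
  have N_sub: "additive_subgroup N M"
    by (simp add: additive_subgroup.intro N.subgroup_axioms)
  interpret N: abelian_subgroup N M
    by (rule abelian_subgroupI3[OF N_sub]) (rule M.abelian_group_axioms)
  have sm: "(\<Union>y\<in>N +>\<^bsub>M\<^esub> x. N +>\<^bsub>M\<^esub> (d \<odot>\<^bsub>M\<^esub> y)) = N +>\<^bsub>M\<^esub> (d \<odot>\<^bsub>M\<^esub> x)"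
    if d: "d \<in> carrier R" and x: "x \<in> carrier M" for d x
  proof -
    have "N +>\<^bsub>M\<^esub> (d \<odot>\<^bsub>M\<^esub> y) = N +>\<^bsub>M\<^esub> (d \<odot>\<^bsub>M\<^esub> x)" if "y \<in> N +>\<^bsub>M\<^esub> x" for y
    proof -
      from that obtain n where n: "n \<in> N" "y = n \<oplus>\<^bsub>M\<^esub> x"
        by (auto simp: a_r_coset_def')
      then have "d \<odot>\<^bsub>M\<^esub> y = d \<odot>\<^bsub>M\<^esub> n \<oplus>\<^bsub>M\<^esub> d \<odot>\<^bsub>M\<^esub> x"
        using d x N.a_Hcarr by (simp add: smult_r_distr)
      moreover have "d \<odot>\<^bsub>M\<^esub> n \<in> N"
        using d n by simp
      ultimately have "d \<odot>\<^bsub>M\<^esub> y \<in> N +>\<^bsub>M\<^esub> (d \<odot>\<^bsub>M\<^esub> x)"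
        by (auto simp: a_r_coset_def')
      then show ?thesis
        using d x N.a_repr_independence' by simp
    qed
    moreover have "x \<in> N +>\<^bsub>M\<^esub> x"
      using x N.a_rcos_self by simp
    ultimately show ?thesis by (intro equalityI subsetI) (blast+)
  qed
  have carr: "\<exists>x\<in>carrier M. X = N +>\<^bsub>M\<^esub> x" if "X \<in> a_rcosets\<^bsub>M\<^esub> N" for X
    using that by (auto simp: A_RCOSETS_def')
  have mem: "N +>\<^bsub>M\<^esub> x \<in> a_rcosets\<^bsub>M\<^esub> N" if "x \<in> carrier M" for x
    using that by (auto simp: A_RCOSETS_def')
  have add: "(N +>\<^bsub>M\<^esub> x) <+>\<^bsub>M\<^esub> (N +>\<^bsub>M\<^esub> y) = N +>\<^bsub>M\<^esub> (x \<oplus>\<^bsub>M\<^esub> y)"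
    if "x \<in> carrier M" "y \<in> carrier M" for x y
    using that by (rule N.a_rcos_sum)
  have ab: "abelian_group (quotient_module M N)"
  proof (rule abelian_groupI; simp add: quotient_module_def)
    show "N \<in> a_rcosets\<^bsub>M\<^esub> N"
      using N.a_subgroup_in_rcosets by simp
    show "X <+>\<^bsub>M\<^esub> Y \<in> a_rcosets\<^bsub>M\<^esub> N" if "X \<in> a_rcosets\<^bsub>M\<^esub> N" "Y \<in> a_rcosets\<^bsub>M\<^esub> N" for X Y
      using carr[OF that(1)] carr[OF that(2)] by (auto simp: add mem)
    show "X <+>\<^bsub>M\<^esub> Y <+>\<^bsub>M\<^esub> Z = X <+>\<^bsub>M\<^esub> (Y <+>\<^bsub>M\<^esub> Z)"
      if "X \<in> a_rcosets\<^bsub>M\<^esub> N" "Y \<in> a_rcosets\<^bsub>M\<^esub> N" "Z \<in> a_rcosets\<^bsub>M\<^esub> N" for X Y Z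
      using carr[OF that(1)] carr[OF that(2)] carr[OF that(3)] by (auto simp: add M.a_assoc)
    show "X <+>\<^bsub>M\<^esub> Y = Y <+>\<^bsub>M\<^esub> X" if "X \<in> a_rcosets\<^bsub>M\<^esub> N" "Y \<in> a_rcosets\<^bsub>M\<^esub> N" for X Y
      using carr[OF that(1)] carr[OF that(2)] by (auto simp: add M.a_comm)
    show "N <+>\<^bsub>M\<^esub> X = X" if "X \<in> a_rcosets\<^bsub>M\<^esub> N" for X
      using that by (rule N.rcosets_add_eq)
    show "\<exists>Y\<in>a_rcosets\<^bsub>M\<^esub> N. Y <+>\<^bsub>M\<^esub> X = N" if "X \<in> a_rcosets\<^bsub>M\<^esub> N" for X
    proof -
      obtain x where x: "x \<in> carrier M" "X = N +>\<^bsub>M\<^esub> x"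
        using carr[OF \<open>X \<in> a_rcosets\<^bsub>M\<^esub> N\<close>] by blast
      then have "(N +>\<^bsub>M\<^esub> (\<ominus>\<^bsub>M\<^esub> x)) <+>\<^bsub>M\<^esub> X = N"
        by (simp add: add M.l_neg N.a_subset)
      then show ?thesis
        using x mem[of "\<ominus>\<^bsub>M\<^esub> x"] by auto
    qed
  qed
  show ?thesis
  proof (rule moduleI[OF R.is_cring ab]; simp add: quotient_module_def del: UN_UN_flatten UN_simps)
    fix a b X Y assume a: "a \<in> carrier R" and X: "X \<in> a_rcosets\<^bsub>M\<^esub> N"
    obtain x where x: "x \<in> carrier M" "X = N +>\<^bsub>M\<^esub> x"
      using carr[OF X] by blast
    show "(\<Union>x\<in>X. N +>\<^bsub>M\<^esub> a \<odot>\<^bsub>M\<^esub> x) \<in> a_rcosets\<^bsub>M\<^esub> N"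
      using a x by (simp only: sm mem smult_closed)
    show "(\<Union>x\<in>X. N +>\<^bsub>M\<^esub> (a \<oplus> b) \<odot>\<^bsub>M\<^esub> x) =
        (\<Union>x\<in>X. N +>\<^bsub>M\<^esub> a \<odot>\<^bsub>M\<^esub> x) <+>\<^bsub>M\<^esub> (\<Union>x\<in>X. N +>\<^bsub>M\<^esub> b \<odot>\<^bsub>M\<^esub> x)" if "b \<in> carrier R"
      using a x that by (simp only: sm add smult_closed R.add.m_closed smult_l_distr)
    show "(\<Union>x\<in>X. N +>\<^bsub>M\<^esub> (a \<otimes> b) \<odot>\<^bsub>M\<^esub> x) =
        (\<Union>y\<in>\<Union>x\<in>X. N +>\<^bsub>M\<^esub> b \<odot>\<^bsub>M\<^esub> x. N +>\<^bsub>M\<^esub> a \<odot>\<^bsub>M\<^esub> y)" if "b \<in> carrier R"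
      using a x that by (simp only: sm smult_closed R.m_closed smult_assoc1)
    assume "Y \<in> a_rcosets\<^bsub>M\<^esub> N"
    then obtain y where y: "y \<in> carrier M" "Y = N +>\<^bsub>M\<^esub> y"
      using carr by blast
    show "(\<Union>x\<in>X <+>\<^bsub>M\<^esub> Y. N +>\<^bsub>M\<^esub> a \<odot>\<^bsub>M\<^esub> x) =
        (\<Union>x\<in>X. N +>\<^bsub>M\<^esub> a \<odot>\<^bsub>M\<^esub> x) <+>\<^bsub>M\<^esub> (\<Union>x\<in>Y. N +>\<^bsub>M\<^esub> a \<odot>\<^bsub>M\<^esub> x)"
      using a x y by (simp only: sm add smult_closed M.add.m_closed smult_r_distr)
  next
    fix X assume "X \<in> a_rcosets\<^bsub>M\<^esub> N"
    then obtain x where x: "x \<in> carrier M" "X = N +>\<^bsub>M\<^esub> x"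
      using carr by blast
    then show "(\<Union>x\<in>X. N +>\<^bsub>M\<^esub> \<one> \<odot>\<^bsub>M\<^esub> x) = X"
      by (simp only: sm R.one_closed smult_one)
  qed
qed

section \<open>Idealization and annihilating ideals\<close>

definition idealization :: "('a, 'c) ring_scheme \<Rightarrow> ('a, 'm, 'd) module_scheme \<Rightarrow> ('a \<times> 'm) ring"
  where "idealization D M =
    \<lparr>carrier = carrier D \<times> carrier M,
     mult = (\<lambda>(d, m) (d', m'). (d \<otimes>\<^bsub>D\<^esub> d', d \<odot>\<^bsub>M\<^esub> m' \<oplus>\<^bsub>M\<^esub> d' \<odot>\<^bsub>M\<^esub> m)),
     one = (\<one>\<^bsub>D\<^esub>, \<zero>\<^bsub>M\<^esub>),
     zero = (\<zero>\<^bsub>D\<^esub>, \<zero>\<^bsub>M\<^esub>),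
     add = (\<lambda>(d, m) (d', m'). (d \<oplus>\<^bsub>D\<^esub> d', m \<oplus>\<^bsub>M\<^esub> m'))\<rparr>"

definition annihilator :: "('r, 'c) ring_scheme \<Rightarrow> 'r set \<Rightarrow> 'r set"
  where "annihilator R I = {r \<in> carrier R. \<forall>x\<in>I. r \<otimes>\<^bsub>R\<^esub> x = \<zero>\<^bsub>R\<^esub>}"

definition nontrivial_ideals :: "('r, 'c) ring_scheme \<Rightarrow> 'r set set"
  where "nontrivial_ideals R = {I. ideal I R \<and> I \<noteq> {\<zero>\<^bsub>R\<^esub>} \<and> I \<noteq> carrier R}"

definition annihilating_ideals :: "('r, 'c) ring_scheme \<Rightarrow> 'r set set"
  where "annihilating_ideals R = {I \<in> nontrivial_ideals R. annihilator R I \<noteq> {\<zero>\<^bsub>R\<^esub>}}"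

lemma (in module) cring_idealization: "cring (idealization R M)"
proof (intro cringI abelian_groupI comm_monoidI)
  fix p assume "p \<in> carrier (idealization R M)"
  then obtain d m where p: "p = (d, m)" "d \<in> carrier R" "m \<in> carrier M"
    by (auto simp: idealization_def)
  then show "\<exists>q\<in>carrier (idealization R M). q \<oplus>\<^bsub>idealization R M\<^esub> p = \<zero>\<^bsub>idealization R M\<^esub>"
    by (intro bexI[of _ "(\<ominus>\<^bsub>R\<^esub> d, \<ominus>\<^bsub>M\<^esub> m)"]) (auto simp: idealization_def R.l_neg M.l_neg)
qed (auto simp: idealization_def smult_l_distr smult_r_distr R.l_distr R.r_distr
      smult_assoc1[symmetric] R.a_ac M.a_ac R.m_ac)

end

(* A nonzero annihilator forces an ideal of the idealization into 0 x M, because D is a domain and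
   M is torsion-free; hence there are at most kappa annihilating ideals. Conversely, a homomorphism
   f from I to M/N is recovered from the proper nonzero ideal {(a, m). a \<in> I, m \<in> f a}, where the
   coset f a is a subset of M; this set is closed under multiplication since IM is contained in N. *)

theory Submission
  imports Defs
begin

text \<open>Negatives come for free as multiples by \<open>\<ominus> \<one>\<close>, zero then
  follows from nonemptiness, and commutativity supplies multiplication on the other side.\<close>

lemma (in cring) idealI_nonempty:
  assumes "J \<subseteq> carrier R" "J \<noteq> {}"
    and add: "\<And>x y. \<lbrakk>x \<in> J; y \<in> J\<rbrakk> \<Longrightarrow> x \<oplus> y \<in> J"
    and mult: "\<And>r x. \<lbrakk>r \<in> carrier R; x \<in> J\<rbrakk> \<Longrightarrow> r \<otimes> x \<in> J"
  shows "ideal J R"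
proof (rule idealI[OF ring_axioms])
  show "subgroup J (add_monoid R)"
  proof (rule add.subgroupI)
    fix x assume "x \<in> J"
    moreover have "\<ominus> x = (\<ominus> \<one>) \<otimes> x"
      using \<open>x \<in> J\<close> assms(1) by (simp add: l_minus subset_iff)
    ultimately show "\<ominus> x \<in> J"
      using mult[of "\<ominus> \<one>" x] by simp
  qed (use assms(1,2) add in auto)
  show "x \<otimes> a \<in> J" if "a \<in> J" "x \<in> carrier R" for a x
    using that by (rule mult[rotated])
  then show "a \<otimes> x \<in> J" if "a \<in> J" "x \<in> carrier R" for a x
    using that assms(1) by (simp add: m_comm subset_iff)
qed

lemma idealization_simps:
  "carrier (idealization D M) = carrier D \<times> carrier M"
  "\<zero>\<^bsub>idealization D M\<^esub> = (\<zero>\<^bsub>D\<^esub>, \<zero>\<^bsub>M\<^esub>)"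
  "(d, m) \<oplus>\<^bsub>idealization D M\<^esub> (d', m') = (d \<oplus>\<^bsub>D\<^esub> d', m \<oplus>\<^bsub>M\<^esub> m')"
  "(d, m) \<otimes>\<^bsub>idealization D M\<^esub> (d', m') = (d \<otimes>\<^bsub>D\<^esub> d', d \<odot>\<^bsub>M\<^esub> m' \<oplus>\<^bsub>M\<^esub> d' \<odot>\<^bsub>M\<^esub> m)"
  by (simp_all add: idealization_def)

context module
begin

text \<open>Since \<open>(a, 0) (0, m) = (0, a m)\<close>, scalar multiplication on the slice over
  zero is multiplication by ring elements \<open>(a, 0)\<close>, under which \<open>J\<close> is
  closed.\<close>

lemma submodule_of_ideal_idealization:
  assumes "ideal J (idealization R M)"
  shows "submodule {m. (\<zero>, m) \<in> J} R M"
proof -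
  interpret S: cring "idealization R M" by (rule cring_idealization)
  interpret J: ideal J "idealization R M" by fact
  have carr: "m \<in> carrier M" if "(\<zero>, m) \<in> J" for m
    using J.Icarr[OF that] by (simp add: idealization_simps)
  have smult: "(\<zero>, a \<odot>\<^bsub>M\<^esub> m) \<in> J" if "a \<in> carrier R" "(\<zero>, m) \<in> J" for a m
    using J.I_l_closed[OF that(2), of "(a, \<zero>\<^bsub>M\<^esub>)"] that carr[OF that(2)]
    by (simp add: idealization_simps)
  show ?thesis
  proof (rule submoduleI)
    show "\<zero>\<^bsub>M\<^esub> \<in> {m. (\<zero>, m) \<in> J}"
      using J.zero_closed by (simp add: idealization_simps)
    show "\<ominus>\<^bsub>M\<^esub> m \<in> {m. (\<zero>, m) \<in> J}" if "m \<in> {m. (\<zero>, m) \<in> J}" for m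
      using smult[of "\<ominus> \<one>" m] that carr by (simp add: smult_l_minus)
    show "m \<oplus>\<^bsub>M\<^esub> m' \<in> {m. (\<zero>, m) \<in> J}" if "m \<in> {m. (\<zero>, m) \<in> J}" "m' \<in> {m. (\<zero>, m) \<in> J}" for m m'
      using J.a_closed[of "(\<zero>, m)" "(\<zero>, m')"] that by (simp add: idealization_simps)
  qed (use carr smult in auto)
qed

text \<open>Suppose a nonzero \<open>(r, x)\<close> kills \<open>(d, m)\<close> with
  \<open>d\<close> nonzero. The first coordinate \<open>r d = 0\<close> gives \<open>r = 0\<close>
  in a domain; the second, \<open>r m + d x = 0\<close>, then reduces to \<open>d x = 0\<close>, so
  \<open>x = 0\<close> by torsion-freeness, a contradiction.\<close>

lemma annihilating_ideal_fst_zero: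
  assumes "domain R" "torsion_free R M"
    and J: "J \<in> annihilating_ideals (idealization R M)" and dm: "(d, m) \<in> J"
  shows "d = \<zero>"
proof (rule ccontr)
  assume d: "d \<noteq> \<zero>"
  interpret R: domain R by fact
  interpret S: cring "idealization R M" by (rule cring_idealization)
  interpret J: ideal J "idealization R M"
    using J by (simp add: annihilating_ideals_def nontrivial_ideals_def)
  have carr: "d \<in> carrier R" "m \<in> carrier M"
    using J.Icarr[OF dm] by (simp_all add: idealization_simps)
  \<comment> \<open>An annihilator different from the zero set yields a nonzero element only once it
    is known to contain zero, that is, not to be empty.\<close>
  have "(\<zero>, \<zero>\<^bsub>M\<^esub>) \<in> annihilator (idealization R M) J"
    using S.l_null J.Icarr by (simp add: annihilator_def flip: idealization_simps(2)[of R M])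
  then obtain r x where rx: "(r, x) \<in> annihilator (idealization R M) J" "(r, x) \<noteq> (\<zero>, \<zero>\<^bsub>M\<^esub>)"
    using J by (auto simp: annihilating_ideals_def idealization_simps)
  then have "r \<in> carrier R" "x \<in> carrier M"
    and "(r, x) \<otimes>\<^bsub>idealization R M\<^esub> (d, m) = (\<zero>, \<zero>\<^bsub>M\<^esub>)"
    using dm by (auto simp: annihilator_def idealization_simps)
  then have "r = \<zero>" "d \<odot>\<^bsub>M\<^esub> x = \<zero>\<^bsub>M\<^esub>"
    using carr d R.integral[of r d] by (auto simp: idealization_simps)
  then show False
    using \<open>torsion_free R M\<close> rx(2) d carr \<open>x \<in> carrier M\<close> by (auto simp: torsion_free_def)
qed

lemma annihilating_ideals_lepoll_submodules:
  assumes "domain R" "torsion_free R M"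
  shows "annihilating_ideals (idealization R M) \<lesssim> nonzero_submodules R M"
proof -
  define \<phi> where "\<phi> J = {m. (\<zero>, m) \<in> J}" for J :: "('a \<times> 'c) set"
  have eq: "J = Pair \<zero> ` \<phi> J" if "J \<in> annihilating_ideals (idealization R M)" for J
    by (auto simp: \<phi>_def image_iff dest: annihilating_ideal_fst_zero[OF assms that])
  have "inj_on \<phi> (annihilating_ideals (idealization R M))"
    by (rule inj_on_inverseI[where g = "(`) (Pair \<zero>)"]) (rule eq[symmetric])
  moreover have "\<phi> J \<in> nonzero_submodules R M" if J: "J \<in> annihilating_ideals (idealization R M)" for J
  proof -
    have "ideal J (idealization R M)" "J \<noteq> {(\<zero>, \<zero>\<^bsub>M\<^esub>)}"
      using J by (auto simp: annihilating_ideals_def nontrivial_ideals_def idealization_simps)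
    moreover have "\<phi> J \<noteq> {\<zero>\<^bsub>M\<^esub>}"
    proof
      assume "\<phi> J = {\<zero>\<^bsub>M\<^esub>}"
      with eq[OF J] have "J = Pair \<zero> ` {\<zero>\<^bsub>M\<^esub>}"
        by (rule subst[rotated])
      with \<open>J \<noteq> _\<close> show False
        by simp
    qed
    ultimately show ?thesis
      using submodule_of_ideal_idealization by (simp add: nonzero_submodules_def \<phi>_def)
  qed
  ultimately show ?thesis
    unfolding lepoll_def by blast
qed

text \<open>The values of \<open>f\<close> are cosets, so the set consists of all
  \<open>(a, m)\<close> with \<open>m\<close> representing \<open>f a\<close> modulo
  \<open>N\<close>. In \<open>(r, x) (b, n) = (r b, r n + b x)\<close> the term \<open>r n\<close>
  represents \<open>f (r b)\<close>, and \<open>b x\<close> lies in \<open>IM\<close>, hence in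
  \<open>N\<close>, and does not change the coset.\<close>

lemma graph_ideal_nontrivial:
  assumes I: "ideal I R" "I \<noteq> {\<zero>}" "I \<noteq> carrier R"
    and N: "submodule N R M" and IM: "ideal_smult I M \<subseteq> N"
    and f: "f \<in> module_Hom R (ideal_module R I) (quotient_module M N)"
  shows "(SIGMA a:I. f a) \<in> nontrivial_ideals (idealization R M)"
proof -
  interpret S: cring "idealization R M" by (rule cring_idealization)
  interpret I: ideal I R by fact
  interpret N: submodule N R M by fact
  have N_sub: "additive_subgroup N M"
    by (simp add: additive_subgroup.intro N.subgroup_axioms)
  interpret N: abelian_subgroup N M
    by (rule abelian_subgroupI3[OF N_sub]) (rule M.abelian_group_axioms)
  have rcos: "f a \<in> a_rcosets\<^bsub>M\<^esub> N" if "a \<in> I" for a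
    using f that by (auto simp: module_Hom_def ideal_module_def quotient_module_def)
  have sub: "f a \<subseteq> carrier M" if "a \<in> I" for a
    using rcos[OF that] N.a_rcosets_carrier by blast
  have nonempty: "f a \<noteq> {}" if "a \<in> I" for a
    using rcos[OF that] N.a_rcos_self by (auto simp: A_RCOSETS_def')
  have add: "f (a \<oplus> b) = f a <+>\<^bsub>M\<^esub> f b" if "a \<in> I" "b \<in> I" for a b
    using f that by (simp add: module_Hom_def ideal_module_def quotient_module_def)
  have smult: "f (r \<otimes> a) = (\<Union>x\<in>f a. N +>\<^bsub>M\<^esub> r \<odot>\<^bsub>M\<^esub> x)" if "r \<in> carrier R" "a \<in> I" for r a
    using f that by (simp add: module_Hom_def ideal_module_def quotient_module_def)
  \<comment> \<open>The pair \<open>(a, m)\<close> shows both that the set is nonempty and that it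
    is not the zero ideal.\<close>
  obtain a where a: "a \<in> I" "a \<noteq> \<zero>"
    using I(2) I.zero_closed by blast
  obtain m where m: "m \<in> f a"
    using nonempty[OF a(1)] by blast
  have "ideal (SIGMA a:I. f a) (idealization R M)"
  proof (rule S.idealI_nonempty)
    show "(SIGMA a:I. f a) \<subseteq> carrier (idealization R M)"
      using sub I.a_subset by (force simp: idealization_simps)
    show "(SIGMA a:I. f a) \<noteq> {}"
      using a m by blast
    show "p \<oplus>\<^bsub>idealization R M\<^esub> q \<in> (SIGMA a:I. f a)"
      if "p \<in> (SIGMA a:I. f a)" "q \<in> (SIGMA a:I. f a)" for p q
    proof -
      obtain b n c k where p: "p = (b, n)" "b \<in> I" "n \<in> f b" and q: "q = (c, k)" "c \<in> I" "k \<in> f c"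
        using \<open>p \<in> _\<close> \<open>q \<in> _\<close> by blast
      \<comment> \<open>Addition in the quotient is the elementwise sum of cosets, so sums of
        representatives represent the sum.\<close>
      have "n \<oplus>\<^bsub>M\<^esub> k \<in> f (b \<oplus> c)"
        unfolding add[OF p(2) q(2)] set_add_def' using p(3) q(3) by blast
      then show ?thesis
        using p q by (simp add: idealization_simps)
    qed
    show "p \<otimes>\<^bsub>idealization R M\<^esub> q \<in> (SIGMA a:I. f a)"
      if "p \<in> carrier (idealization R M)" "q \<in> (SIGMA a:I. f a)" for p q
    proof -
      obtain r x where p: "p = (r, x)" "r \<in> carrier R" "x \<in> carrier M"
        using \<open>p \<in> _\<close> by (auto simp: idealization_simps)
      obtain b n where q: "q = (b, n)" "b \<in> I" "n \<in> f b"
        using \<open>q \<in> _\<close> by blast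
      have n: "n \<in> carrier M"
        using sub q by blast
      have "b \<odot>\<^bsub>M\<^esub> x \<in> N"
        using IM ideal_smult.prod[OF q(2) p(3)] by blast
      then have "b \<odot>\<^bsub>M\<^esub> x \<oplus>\<^bsub>M\<^esub> r \<odot>\<^bsub>M\<^esub> n \<in> N +>\<^bsub>M\<^esub> r \<odot>\<^bsub>M\<^esub> n"
        by (auto simp: a_r_coset_def')
      \<comment> \<open>By \<open>smult\<close>, \<open>f (r \<otimes> b)\<close> is the union of
        the cosets of \<open>r y\<close> over all \<open>y\<close> in \<open>f b\<close>, and
        \<open>n\<close> is one such \<open>y\<close>.\<close>
      then have "r \<odot>\<^bsub>M\<^esub> n \<oplus>\<^bsub>M\<^esub> b \<odot>\<^bsub>M\<^esub> x \<in> f (r \<otimes> b)"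
        using smult[OF p(2) q(2)] p q n I.Icarr by (auto simp: M.a_comm)
      then show ?thesis
        using p q I.I_l_closed by (simp add: idealization_simps)
    qed
  qed
  moreover have "(SIGMA a:I. f a) \<noteq> {(\<zero>, \<zero>\<^bsub>M\<^esub>)}"
    using a m by blast
  \<comment> \<open>First coordinates stay in the proper ideal \<open>I\<close>, whereas those of
    the whole ring, already in the pairs \<open>(d, 0)\<close>, run through all of
    \<open>R\<close>.\<close>
  moreover have "(SIGMA a:I. f a) \<noteq> carrier R \<times> carrier M"
  proof
    assume "(SIGMA a:I. f a) = carrier R \<times> carrier M"
    then have "carrier R \<subseteq> I"
      using M.zero_closed by blast
    then show False
      using I(3) I.a_subset by blast
  qed
  ultimately show ?thesis
    by (simp add: nontrivial_ideals_def idealization_simps)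
qed

text \<open>The fibre of the ideal over \<open>a\<close> is \<open>f a\<close>, which determines
  \<open>f\<close> on \<open>I\<close>; outside \<open>I\<close> all members of
  \<open>module_Hom\<close> agree by extensionality.\<close>

lemma module_Hom_lepoll_nontrivial_ideals:
  assumes "ideal I R" "I \<noteq> {\<zero>}" "I \<noteq> carrier R"
    and "submodule N R M" "ideal_smult I M \<subseteq> N"
  shows "module_Hom R (ideal_module R I) (quotient_module M N) \<lesssim>
    nontrivial_ideals (idealization R M)"
proof -
  have "inj_on (Sigma I) (module_Hom R (ideal_module R I) (quotient_module M N))"
  proof (rule inj_onI)
    fix f g assume fg: "f \<in> module_Hom R (ideal_module R I) (quotient_module M N)"
      "g \<in> module_Hom R (ideal_module R I) (quotient_module M N)"
      and eq: "(SIGMA a:I. f a) = (SIGMA a:I. g a)"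
    show "f = g"
    proof (rule extensionalityI[of _ I])
      \<comment> \<open>The fibre over \<open>a\<close> is the image of \<open>{a}\<close> under the
        set of pairs read as a relation.\<close>
      show "f a = g a" if "a \<in> I" for a
        using arg_cong[OF eq, of "\<lambda>J. J `` {a}"] that by auto
    qed (use fg in \<open>auto simp: module_Hom_def ideal_module_def PiE_def\<close>)
  qed
  then show ?thesis
    unfolding lepoll_def using graph_ideal_nontrivial[OF assms] by blast
qed

end

theorem proposition2p4:
  fixes D :: "('a, 'c) ring_scheme" and M :: "('a, 'm, 'd) module_scheme"
    and I :: "'a set" and N :: "'m set"
  assumes "domain D"
    and "module D M"
    and "torsion_free D M"
    and "ideal I D" and "I \<noteq> {\<zero>\<^bsub>D\<^esub>}" and "I \<noteq> carrier D"
    and "submodule N D M"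
    and "ideal_smult I M \<subseteq> N"
    and "nonzero_submodules D M \<prec> module_Hom D (ideal_module D I) (quotient_module M N)"
  shows "annihilating_ideals (idealization D M) \<prec> nontrivial_ideals (idealization D M)"
proof -
  interpret module D M by fact
  show ?thesis
    \<comment> \<open>The assumed strict inequality between submodules and homomorphisms stands
      between two injections, which preserve strictness on either side.\<close>
    using annihilating_ideals_lepoll_submodules[OF assms(1,3)] assms(9)
      module_Hom_lepoll_nontrivial_ideals[OF assms(4-8)]
    by (rule lesspoll_trans2[OF lesspoll_trans1])
qed

end
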